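(* Let $\mu$ be $\sigma$-finite, let $1<p<\infty$, and let $q$ be the conjugate exponent of $p$. Let $\{\Lambda_\omega\}_{\omega\in\Omega}$ be a Bochner $pg$-frame for $X$ with respect to $\{H_\omega\}_{\omega\in\Omega}$ with lower and upper Bochner $pg$-frame bounds $A$ and $B$. Let $\{\Theta_\omega\in B(X,H_\omega):\omega\in\Omega\}$ be a family such that for all $x\in X$ the map $\omega\mapsto\Theta_\omega(x)$ is Bochner measurable. Assume that there exist constants $\lambda_1,\lambda_2,\gamma$ such that $$0\le\lambda_2<1,\qquad -\lambda_2\le\lambda_1<1,\qquad 0\le\gamma<(1-\lambda_1-2\lambda_2)A,$$ and $$\Big|\int_\Omega\langle(\Lambda_\omega-\Theta_\omega)x,G(\omega)\rangle d\mu(\omega)\Big|\le\lambda_1\Big|\int_\Omega\langle\Lambda_\omega x,G(\omega)\rangle d\mu(\omega)\Big|+\lambda_2\Big|\int_\Omega\langle\Theta_\omega x,G(\omega)\rangle d\mu(\omega)\Big|+\gamma\|G\|_q$$ for all $G\in L^q(\mu,\oplus_{\omega\in\Omega}H_\omega)$ and $x\in X$. Then $\{\Theta_\omega\}_{\omega\in\Omega}$ is a Bochner $pg$-frame for $X$ with respect to $\{H_\omega\}_{\omega\in\Omega}$ with (lower and upper) bounds $$A\left[\frac{(1-\lambda_1-2\lambda_2)-\frac{\gamma}{A}}{1-\lambda_2}\right]\qquad\text{and}\qquad B\left[\frac{1+\lambda_1+\frac{\gamma}{B}}{1-\lambda_2}\right].$$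
   Context: $X$ is a Banach space, $(\Omega,\Sigma,\mu)$ is a measure space with $\mu$ a positive measure, and $\{H_\omega\}_{\omega\in\Omega}$ is a family of Hilbert spaces. $B(X,H_\omega)$ is the space of bounded linear operators from $X$ to $H_\omega$. Put $K=\oplus_{\omega\in\Omega}H_\omega$ (Hilbert space direct sum), with each $H_\omega$ regarded as a subspace of $K$. A function $f$ from $\Omega$ to a Banach space is Bochner measurable if there are simple functions $f_n$ with $\|f_n(\omega)-f(\omega)\|\to0$ for $\mu$-a.e. $\omega$. For $1\le r<\infty$, $L^r(\mu,K)$ is the Bochner space of (classes of) Bochner measurable $F:\Omega\to K$ with $\|F\|_r=(\int_\Omega\|F(\omega)\|^r d\mu(\omega))^{1/r}<\infty$. Pairing: $\nu:K\to K^*$ is a fixed isometric (linear) isomorphism between $K$ and $K^*$, and for $u,v\in K$, $\langle u,v\rangle:=\nu(v)(u)$ (not the inner product). The integrals in the hypothesis are understood to exist and be finite. Bochner $pg$-frame ($1<p<\infty$): a family $\{\Lambda_\omega\in B(X,H_\omega)\}_{\omega\in\Omega}$ is a Bochner $pg$-frame for $X$ with respect to $\{H_\omega\}_{\omega\in\Omega}$ if (i) for each $x\in X$, $\omega\mapsto\Lambda_\omega(x)$ is Bochner measurable, and (ii) there are positive constants $A,B$ with $A\|x\|\le(\int_\Omega\|\Lambda_\omega(x)\|^p d\mu(\omega))^{1/p}\le B\|x\|$ for all $x\in X$. $A$ and $B$ are called lower and upper Bochner $pg$-frame bounds. *)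

theory Defs
  imports "HOL-Analysis.Analysis"
begin

text \<open>
  Scalars: a type of class \<open>{real_normed_field, euclidean_space}\<close> is, up to isometric isomorphism,
  the real or the complex field, and both \<^typ>\<open>real\<close> and \<^typ>\<open>complex\<close> are instances. Working over
  such a type treats real and complex Banach and Hilbert spaces at the same time.
  The real part of a scalar is its real inner product with 1, which yields conjugation.
\<close>

definition conjg :: "'s::{real_normed_field,euclidean_space} \<Rightarrow> 's" where
  "conjg z = of_real (2 * (z \<bullet> 1)) - z"

lemma conjg_real: "conjg (x :: real) = x"
  by (simp add: conjg_def)

lemma conjg_complex: "conjg (z :: complex) = cnj z"
  by (simp add: conjg_def complex_eq_iff inner_complex_def)

text \<open>
  Completeness comes from the type class \<^class>\<open>banach\<close>; the locale adds the scalar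
  multiplication by \<open>'s\<close>, extending the real one.
\<close>

locale banach_space = vector_space scale
  for scale :: "'s::{real_normed_field,euclidean_space} \<Rightarrow> 'a::banach \<Rightarrow> 'a" +
  assumes scale_of_real: "scale (of_real r) x = r *\<^sub>R x"
    and norm_scale: "norm (scale c x) = norm c * norm x"

locale hilbert_space = banach_space scale
  for scale :: "'s::{real_normed_field,euclidean_space} \<Rightarrow> 'a::banach \<Rightarrow> 'a" +
  fixes ip :: "'a \<Rightarrow> 'a \<Rightarrow> 's"
  assumes ip_add_left: "ip (x + y) z = ip x z + ip y z"
    and ip_scale_left: "ip (scale c x) y = c * ip x y"
    and ip_commute: "ip x y = conjg (ip y x)"
    and ip_self: "ip x x = of_real ((norm x)\<^sup>2)"

text \<open>
  The ambient Hilbert space is the (internal) Hilbert direct sum of the subspaces \<open>H \<omega>\<close>, \<open>\<omega> \<in> \<Omega>\<close>;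
  being closed, each \<open>H \<omega>\<close> is itself a Hilbert space.
\<close>

definition hilbert_direct_sum ::
  "('s::{real_normed_field,euclidean_space} \<Rightarrow> 'k::banach \<Rightarrow> 'k) \<Rightarrow> ('k \<Rightarrow> 'k \<Rightarrow> 's)
    \<Rightarrow> 'w set \<Rightarrow> ('w \<Rightarrow> 'k set) \<Rightarrow> bool" where
  "hilbert_direct_sum sc ip \<Omega> H \<longleftrightarrow>
     (\<forall>\<omega>\<in>\<Omega>. module.subspace sc (H \<omega>) \<and> closed (H \<omega>)) \<and>
     (\<forall>\<omega>\<in>\<Omega>. \<forall>\<eta>\<in>\<Omega>. \<omega> \<noteq> \<eta> \<longrightarrow> (\<forall>u\<in>H \<omega>. \<forall>v\<in>H \<eta>. ip u v = 0)) \<and>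
     closure (module.span sc (\<Union>\<omega>\<in>\<Omega>. H \<omega>)) = UNIV"

text \<open>
  \<open>bounded_operators scX scY S\<close> is the space \<open>B(X, S)\<close> for a closed subspace \<open>S\<close> of \<open>Y\<close>.
  \<^const>\<open>bounded_linear\<close> by itself only gives real linearity.
\<close>

definition bounded_operators ::
  "('s::{real_normed_field,euclidean_space} \<Rightarrow> 'x::real_normed_vector \<Rightarrow> 'x)
    \<Rightarrow> ('s \<Rightarrow> 'y::real_normed_vector \<Rightarrow> 'y) \<Rightarrow> 'y set \<Rightarrow> ('x \<Rightarrow> 'y) set" where
  "bounded_operators scX scY S =
     {f. Vector_Spaces.linear scX scY f \<and> bounded_linear f \<and> range f \<subseteq> S}"

abbreviation dual_space ::
  "('s::{real_normed_field,euclidean_space} \<Rightarrow> 'k::real_normed_vector \<Rightarrow> 'k) \<Rightarrow> ('k \<Rightarrow> 's) set" where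
  "dual_space sc \<equiv> bounded_operators sc (*) UNIV"

definition isometric_isomorphism_to_dual ::
  "('s::{real_normed_field,euclidean_space} \<Rightarrow> 'k::real_normed_vector \<Rightarrow> 'k)
    \<Rightarrow> ('k \<Rightarrow> 'k \<Rightarrow> 's) \<Rightarrow> bool" where
  "isometric_isomorphism_to_dual sc \<nu> \<longleftrightarrow>
     (\<forall>v w u. \<nu> (v + w) u = \<nu> v u + \<nu> w u) \<and>
     (\<forall>c v u. \<nu> (sc c v) u = c * \<nu> v u) \<and>
     (\<forall>v. onorm (\<nu> v) = norm v) \<and>
     bij_betw \<nu> UNIV (dual_space sc)"

definition bochner_measurable :: "'w measure \<Rightarrow> ('w \<Rightarrow> 'b::real_normed_vector) \<Rightarrow> bool" where
  "bochner_measurable M f \<longleftrightarrow>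
     (\<exists>s. (\<forall>n::nat. simple_function M (s n)) \<and>
          (AE \<omega> in M. (\<lambda>n. norm (s n \<omega> - f \<omega>)) \<longlonglongrightarrow> 0))"

text \<open>
  A Bochner measurable function, being only an almost everywhere limit of simple functions, need
  not be measurable with respect to \<open>M\<close>, only with respect to its completion. Hence integrals
  are taken over \<^term>\<open>completion M\<close>; for \<open>M\<close>-measurable integrands this makes no difference.
\<close>

definition bochner_Lp :: "'w measure \<Rightarrow> real \<Rightarrow> ('w \<Rightarrow> 'b::real_normed_vector) set" where
  "bochner_Lp M r =
     {F. bochner_measurable M F \<and> integrable (completion M) (\<lambda>\<omega>. norm (F \<omega>) powr r)}"

definition Lp_norm :: "'w measure \<Rightarrow> real \<Rightarrow> ('w \<Rightarrow> 'b::real_normed_vector) \<Rightarrow> real" where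
  "Lp_norm M r F = (LINT \<omega>|completion M. norm (F \<omega>) powr r) powr (1 / r)"

text \<open>
  Membership in \<^const>\<open>bochner_Lp\<close> says that \<open>\<omega> \<mapsto> \<Lambda> \<omega> x\<close> is Bochner measurable and that the integral
  in the frame inequality is finite, as the upper inequality demands.
\<close>

definition bochner_pg_frame ::
  "'w measure \<Rightarrow> real \<Rightarrow> ('s::{real_normed_field,euclidean_space} \<Rightarrow> 'x::banach \<Rightarrow> 'x)
    \<Rightarrow> ('s \<Rightarrow> 'k::banach \<Rightarrow> 'k) \<Rightarrow> ('w \<Rightarrow> 'k set) \<Rightarrow> ('w \<Rightarrow> 'x \<Rightarrow> 'k) \<Rightarrow> real \<Rightarrow> real \<Rightarrow> bool" where
  "bochner_pg_frame M p scX scK H \<Lambda> A B \<longleftrightarrow>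
     0 < A \<and> 0 < B \<and>
     (\<forall>\<omega>\<in>space M. \<Lambda> \<omega> \<in> bounded_operators scX scK (H \<omega>)) \<and>
     (\<forall>x. (\<lambda>\<omega>. \<Lambda> \<omega> x) \<in> bochner_Lp M p) \<and>
     (\<forall>x. A * norm x \<le> Lp_norm M p (\<lambda>\<omega>. \<Lambda> \<omega> x) \<and> Lp_norm M p (\<lambda>\<omega>. \<Lambda> \<omega> x) \<le> B * norm x)"

end

theory Submission
  imports Defs
begin

text \<open>
  Write \<open>a\<close> and \<open>b\<close> for the integrals of \<open>\<langle>\<Lambda>\<^sub>\<omega> x, G(\<omega>)\<rangle>\<close> and \<open>\<langle>\<Theta>\<^sub>\<omega> x, G(\<omega>)\<rangle>\<close>. Both are linear in \<open>x\<close>, whereas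
  \<open>\<gamma> \<parallel>G\<parallel>\<close> does not depend on \<open>x\<close>. Applying the perturbation inequality to \<open>n x\<close>, dividing by \<open>n\<close> and
  letting \<open>n\<close> tend to infinity gives \<open>\<bar>a - b\<bar> \<le> \<lambda>\<^sub>1 \<bar>a\<bar> + \<lambda>\<^sub>2 \<bar>b\<bar>\<close>, and the triangle inequality turns this into
  \<open>(1 - \<lambda>\<^sub>2) \<bar>b\<bar> \<le> (1 + \<lambda>\<^sub>1) \<bar>a\<bar>\<close> and \<open>(1 - \<lambda>\<^sub>1) \<bar>a\<bar> \<le> (1 + \<lambda>\<^sub>2) \<bar>b\<bar>\<close>.

  The \<open>L\<^sup>p\<close> norm of a function \<open>F\<close> is the least \<open>C\<close> such that the pairing of \<open>F\<close> with \<open>G\<close> is at most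
  \<open>C \<parallel>G\<parallel>\<close> for all \<open>G\<close> in \<open>L\<^sup>q\<close>. One half of this is Hoelder's inequality (\<open>Holder_pairing\<close>). The other
  half (\<open>bochner_Lp_if_pairing_bounded\<close>) includes the membership of \<open>F\<close> in \<open>L\<^sup>p\<close>, which has to be proved
  for \<open>\<Theta>\<close>. Hence the two inequalities between \<open>\<bar>a\<bar>\<close> and \<open>\<bar>b\<bar>\<close> carry over to the \<open>L\<^sup>p\<close> norms of \<open>\<Lambda> x\<close>
  and \<open>\<Theta> x\<close>, and \<open>\<Theta>\<close> satisfies the frame inequalities with constants \<open>A (1 - \<lambda>\<^sub>1) / (1 + \<lambda>\<^sub>2)\<close> and
  \<open>B (1 + \<lambda>\<^sub>1) / (1 - \<lambda>\<^sub>2)\<close>. These imply the asserted ones; for the lower bound this follows from \<open>\<gamma> \<ge> 0\<close> and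
  \<open>(1 - \<lambda>\<^sub>1) (1 - \<lambda>\<^sub>2) - (1 - \<lambda>\<^sub>1 - 2 \<lambda>\<^sub>2) (1 + \<lambda>\<^sub>2) = 2 \<lambda>\<^sub>2 (\<lambda>\<^sub>1 + \<lambda>\<^sub>2) \<ge> 0\<close>.

  For the second half of the duality one tests \<open>F\<close> against truncations of \<open>J \<circ> F\<close>, where \<open>J\<close> is the
  duality map \<open>v \<mapsto> \<parallel>v\<parallel>\<^bsup>p - 2\<^esup> R v\<close> and \<open>R\<close> sends \<open>v\<close> to the element that \<open>\<nu>\<close> maps to the functional
  \<open>u \<mapsto> ip u v\<close>. The continuity of \<open>J\<close> makes \<open>J \<circ> F\<close> Bochner measurable. Thus no measurable
  selection of norming functionals has to be made.
\<close>

section \<open>The Riesz map and the duality map of a Hilbert space\<close>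

lemma conjg_add: "conjg (a + b) = conjg a + conjg b"
  by (simp add: conjg_def algebra_simps)

context hilbert_space
begin

lemma ip_add_right: "ip x (y + z) = ip x y + ip x z"
  by (metis conjg_add ip_add_left ip_commute)

lemma ip_scaleR_left: "ip (r *\<^sub>R x) y = of_real r * ip x y"
  by (metis ip_scale_left scale_of_real)

lemma ip_plus_swap: "ip x y + ip y x = of_real (2 * (ip x y \<bullet> 1))"
  using ip_commute[of y x] by (simp add: conjg_def)

text \<open>
  The real part of \<open>ip\<close> is a real inner product with the same norm, so this is the real
  Cauchy-Schwarz inequality: expand the square of the norm of \<open>\<parallel>y\<parallel> x - \<parallel>x\<parallel> y\<close>.
\<close>

lemma ip_Re_le: "ip x y \<bullet> 1 \<le> norm x * norm y"
proof (cases "norm x = 0 \<or> norm y = 0")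
  case True
  then have "ip x y = 0"
    using ip_scale_left[of 0 y x] ip_scale_left[of 0 x y] ip_commute[of x y] 
    by (auto simp: conjg_def)
  then show ?thesis by simp
next
  case False
  define u v where "u = norm y *\<^sub>R x" and "v = - norm x *\<^sub>R y"
  have "of_real ((norm (u + v))\<^sup>2) = ip u u + (ip u v + ip v u) + ip v v"
    by (simp only: ip_self[symmetric] ip_add_left ip_add_right add_ac)
  also have "\<dots> = of_real ((norm u)\<^sup>2 + 2 * (ip v u \<bullet> 1) + (norm v)\<^sup>2)"
    using ip_plus_swap[of v u] by (simp add: ip_self add.commute)
  finally have "(norm (u + v))\<^sup>2 = (norm u)\<^sup>2 + 2 * (ip v u \<bullet> 1) + (norm v)\<^sup>2"
    by (simp only: of_real_eq_iff)
  moreover have "ip v u \<bullet> 1 = - (norm x * norm y * (ip x y \<bullet> 1))"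
  proof -
    have "ip v u = of_real (- norm x) * ip y u"
      by (simp only: v_def ip_scaleR_left)
    also have "\<dots> = - norm x *\<^sub>R ip y u"
      by (simp add: scaleR_conv_of_real)
    finally have 1: "ip v u \<bullet> 1 = - norm x * (ip y u \<bullet> 1)"
      by simp
    have "ip y u \<bullet> 1 = ip u y \<bullet> 1"
      using ip_plus_swap[of u y] ip_plus_swap[of y u] by (simp add: add.commute)
    also have "ip u y = norm y *\<^sub>R ip x y"
      by (simp add: u_def ip_scaleR_left scaleR_conv_of_real)
    finally show ?thesis using 1 by simp
  qed
  ultimately have "0 \<le> 2 * (norm x * norm y)\<^sup>2 - 2 * (norm x * norm y * (ip x y \<bullet> 1))"
    using zero_le_power2[of "norm (u + v)"]
    by (simp add: u_def v_def power_mult_distrib mult.commute)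
  then have "(norm x * norm y) * (ip x y \<bullet> 1) \<le> (norm x * norm y) * (norm x * norm y)"
    by (simp add: power2_eq_square)
  moreover have "0 < norm x * norm y" using False by simp
  ultimately show ?thesis
    by (simp only: mult_le_cancel_left_pos)
qed

text \<open>
  Multiplying \<open>x\<close> by a scalar of norm 1 makes \<open>ip x y\<close> equal to its own norm. This reduces the claim to
  the bound for real parts.
\<close>

lemma ip_Cauchy_Schwarz: "norm (ip x y) \<le> norm x * norm y"
proof (cases "ip x y = 0")
  case False
  define c where "c = of_real (norm (ip x y)) / ip x y"
  have "norm (ip x y) = (of_real (norm (ip x y)) :: 's) \<bullet> 1"
    by (simp add: of_real_def dot_square_norm)
  also have "\<dots> = ip (scale c x) y \<bullet> 1"
    using False by (simp add: ip_scale_left c_def)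
  also have "\<dots> \<le> norm (scale c x) * norm y"
    by (rule ip_Re_le)
  also have "\<dots> = norm x * norm y"
    using False by (simp add: norm_scale c_def norm_divide)
  finally show ?thesis .
qed simp

lemma ip_in_dual: "(\<lambda>u. ip u w) \<in> dual_space scale"
  and onorm_ip: "onorm (\<lambda>u. ip u w) = norm w"
proof -
  have bl: "bounded_linear (\<lambda>u. ip u w)"
  proof (rule bounded_linear_intro)
    show "norm (ip u w) \<le> norm u * norm w" for u
      by (rule ip_Cauchy_Schwarz)
  qed (simp_all add: ip_add_left ip_scaleR_left scaleR_conv_of_real)
  have "Vector_Spaces.linear scale (*) (\<lambda>u. ip u w)"
    by unfold_locales (simp_all add: ip_add_left ip_scale_left algebra_simps)
  with bl show "(\<lambda>u. ip u w) \<in> dual_space scale"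
    by (simp add: bounded_operators_def)
  show "onorm (\<lambda>u. ip u w) = norm w"
  proof (rule antisym)
    show "onorm (\<lambda>u. ip u w) \<le> norm w"
      by (rule onorm_bound) (use ip_Cauchy_Schwarz in \<open>simp_all add: mult.commute\<close>)
    have "norm w * norm w \<le> onorm (\<lambda>u. ip u w) * norm w"
      using onorm[OF bl, of w] by (simp add: ip_self power2_eq_square norm_mult)
    then show "norm w \<le> onorm (\<lambda>u. ip u w)"
      using onorm_pos_le[OF bl] by (cases "norm w = 0") auto
  qed
qed

text \<open>
  \<open>R\<close> is the inverse of \<open>\<nu>\<close> applied to \<open>u \<mapsto> ip u w\<close>. Only additivity and isometry are recorded, because
  together they give continuity.
\<close>

lemma Riesz_map_exists:
  assumes "isometric_isomorphism_to_dual scale \<nu>"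
  shows "\<exists>R. (\<forall>v w. R (v - w) = R v - R w) \<and> (\<forall>w. norm (R w) = norm w) \<and>
             (\<forall>w u. \<nu> (R w) u = ip u w)"
proof -
  have add: "\<nu> (v + w) u = \<nu> v u + \<nu> w u"
    and norm: "onorm (\<nu> v) = norm v"
    and bij: "bij_betw \<nu> UNIV (dual_space scale)" for u v w
    using assms by (auto simp: isometric_isomorphism_to_dual_def)
  define R where "R w = inv_into UNIV \<nu> (\<lambda>u. ip u w)" for w
  have R: "\<nu> (R w) = (\<lambda>u. ip u w)" for w
    unfolding R_def using bij ip_in_dual[of w]
    by (intro f_inv_into_f) (auto simp: bij_betw_def)
  have "\<nu> (R (v - w) + R w) = \<nu> (R v)" for v w
  proof
    fix u
    show "\<nu> (R (v - w) + R w) u = \<nu> (R v) u"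
      using ip_add_right[of u "v - w" w] by (simp add: add R)
  qed
  then have "R (v - w) + R w = R v" for v w
    using bij by (meson bij_betw_imp_inj_on injD)
  moreover have "norm (R w) = norm w" for w
    using norm[of "R w"] by (simp add: R onorm_ip)
  ultimately show ?thesis
    using R by (intro exI[of _ R]) (auto simp: eq_diff_eq)
qed

text \<open>
  \<open>J v\<close> is the vector that attains equality in Hoelder's inequality against \<open>v\<close>: for the conjugate
  exponent \<open>q\<close> one has \<open>\<parallel>J v\<parallel>\<^sup>q = \<parallel>v\<parallel>\<^sup>p = \<nu> (J v) v\<close>. Although the factor \<open>\<parallel>v\<parallel>\<^bsup>p - 2\<^esup>\<close> may be singular at 0,
  \<open>J\<close> is continuous there, as \<open>\<parallel>J v\<parallel> = \<parallel>v\<parallel>\<^bsup>p - 1\<^esup>\<close> and \<open>p > 1\<close>.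
\<close>

lemma duality_map_exists:
  assumes \<nu>: "isometric_isomorphism_to_dual scale \<nu>" and "1 < p"
  shows "\<exists>J. continuous_on UNIV J \<and> (\<forall>v. norm (J v) = norm v powr (p - 1)) \<and>
             (\<forall>v. \<nu> (J v) v = of_real (norm v powr p))"
proof -
  obtain R where diff: "R (v - w) = R v - R w" and norm: "norm (R w) = norm w"
    and R: "\<nu> (R w) u = ip u w" for u v w
    using Riesz_map_exists[OF \<nu>] by blast
  define J where "J v = norm v powr (p - 2) *\<^sub>R R v" for v
  have norm_J: "norm (J v) = norm v powr (p - 1)" for v
    using powr_mult_base[of "norm v" "p - 2"] by (simp add: J_def norm mult.commute)
  have "isCont R v" for v
  proof -
    have "(\<lambda>w. norm (w - v)) \<midarrow>v\<rightarrow> 0"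
      by (simp add: tendsto_norm_zero_iff LIM_zero_iff)
    then have "(\<lambda>w. norm (R w - R v)) \<midarrow>v\<rightarrow> 0"
      by (simp add: norm flip: diff)
    then show ?thesis
      by (simp add: isCont_def tendsto_norm_zero_iff LIM_zero_iff)
  qed
  then have "isCont J v" for v
  proof (cases "v = 0")
    case False
    then show ?thesis
      using \<open>isCont R v\<close> unfolding J_def by (intro continuous_intros) auto
  next
    case True
    have "(\<lambda>w::'a. norm w powr (p - 1)) \<midarrow>0\<rightarrow> 0"
      using \<open>1 < p\<close> by (intro tendsto_eq_intros tendsto_zero_powrI) (auto intro!: tendsto_eq_intros)
    then have "J \<midarrow>0\<rightarrow> 0"
      by (simp only: norm_J[symmetric] tendsto_norm_zero_iff)
    moreover have "J 0 = 0"
      using norm_J[of 0] \<open>1 < p\<close> by simp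
    ultimately show ?thesis using True by (simp add: isCont_def)
  qed
  moreover have "\<nu> (J v) v = of_real (norm v powr p)" for v
  proof -
    have "\<nu> (J v) v = \<nu> (scale (of_real (norm v powr (p - 2))) (R v)) v"
      by (simp add: J_def scale_of_real)
    also have "\<dots> = of_real (norm v powr (p - 2)) * ip v v"
      using \<nu> by (simp add: isometric_isomorphism_to_dual_def R)
    also have "\<dots> = of_real (norm v powr (p - 2) * norm v powr 2)"
      by (simp add: ip_self)
    also have "norm v powr (p - 2) * norm v powr 2 = norm v powr p"
      by (simp only: powr_add[symmetric]) simp
    finally show ?thesis .
  qed
  ultimately show ?thesis
    using norm_J by (intro exI[of _ J]) (simp add: continuous_on_eq_continuous_within)
qed

end

lemma bounded_linear_dual_pairing:
  assumes "isometric_isomorphism_to_dual sc \<nu>"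
  shows "bounded_linear (\<nu> v)"
proof -
  have "\<nu> v \<in> dual_space sc"
    using assms by (auto simp: isometric_isomorphism_to_dual_def bij_betw_def)
  then show ?thesis
    by (simp add: bounded_operators_def)
qed

lemma dual_pairing_norm_le:
  assumes "isometric_isomorphism_to_dual sc \<nu>"
  shows "norm (\<nu> v u) \<le> norm v * norm u"
  using onorm[OF bounded_linear_dual_pairing[OF assms], of v u] assms
  by (simp add: isometric_isomorphism_to_dual_def)


section \<open>Bochner measurability\<close>

lemma bochner_measurable_compose:
  assumes "bochner_measurable M f" and "continuous_on UNIV g"
  shows "bochner_measurable M (\<lambda>\<omega>. g (f \<omega>))"
proof -
  obtain s where s: "\<And>n::nat. simple_function M (s n)"
    and lim: "AE \<omega> in M. (\<lambda>n. norm (s n \<omega> - f \<omega>)) \<longlonglongrightarrow> 0"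
    using assms(1) by (auto simp: bochner_measurable_def)
  have "AE \<omega> in M. (\<lambda>n. norm (g (s n \<omega>) - g (f \<omega>))) \<longlonglongrightarrow> 0"
    using lim
  proof eventually_elim
    case (elim \<omega>)
    then have "(\<lambda>n. s n \<omega>) \<longlonglongrightarrow> f \<omega>"
      by (simp add: tendsto_norm_zero_iff LIM_zero_iff)
    then have "(\<lambda>n. g (s n \<omega>)) \<longlonglongrightarrow> g (f \<omega>)"
      using continuous_on_tendsto_compose[OF assms(2)] by simp
    then show ?case by (simp add: tendsto_norm_zero_iff LIM_zero_iff)
  qed
  then show ?thesis
    using s unfolding bochner_measurable_def
    by (intro exI[of _ "\<lambda>n \<omega>. g (s n \<omega>)"]) (auto intro: simple_function_compose1)
qed

lemma bochner_measurable_indicator_scaleR: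
  assumes "bochner_measurable M f" and E: "E \<in> sets M"
  shows "bochner_measurable M (\<lambda>\<omega>. indicator E \<omega> *\<^sub>R f \<omega>)"
proof -
  obtain s where s: "\<And>n::nat. simple_function M (s n)"
    and lim: "AE \<omega> in M. (\<lambda>n. norm (s n \<omega> - f \<omega>)) \<longlonglongrightarrow> 0"
    using assms(1) by (auto simp: bochner_measurable_def)
  have "AE \<omega> in M. (\<lambda>n. norm (indicator E \<omega> *\<^sub>R s n \<omega> - indicator E \<omega> *\<^sub>R f \<omega>)) \<longlonglongrightarrow> 0"
    using lim by eventually_elim (simp split: split_indicator)
  moreover have "simple_function M (\<lambda>\<omega>. indicator E \<omega> *\<^sub>R s n \<omega>)" for n
    using simple_function_indicator[OF E] s by (rule simple_function_compose2)
  ultimately show ?thesis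
    unfolding bochner_measurable_def by (intro exI[of _ "\<lambda>n \<omega>. indicator E \<omega> *\<^sub>R s n \<omega>"]) auto
qed

text \<open>
  Every subset of a null set is measurable for the completion, so changing a function on a null set
  keeps it measurable.
\<close>

lemma borel_measurable_completion_cong_AE:
  assumes f: "f \<in> borel_measurable (completion M)" and eq: "AE x in M. f x = g x"
  shows "g \<in> borel_measurable (completion M)"
proof (rule measurableI)
  fix A :: "'b set" assume "A \<in> sets borel"
  then have "f -` A \<inter> space (completion M) \<in> sets (completion M)"
    by (rule measurable_sets[OF f])
  moreover have "AE x in completion M. x \<in> f -` A \<inter> space (completion M) \<longleftrightarrow>
      x \<in> g -` A \<inter> space (completion M)"
    using AE_completion[OF eq] by eventually_elim simp
  ultimately show "g -` A \<inter> space (completion M) \<in> sets (completion M)"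
    using completion.in_sets_AE inf_le2 by blast
qed simp

lemma bochner_measurable_norm:
  assumes "bochner_measurable M f"
  shows "(\<lambda>\<omega>. norm (f \<omega>)) \<in> borel_measurable (completion M)"
proof -
  obtain s where s: "\<And>n::nat. simple_function M (s n)"
    and lim: "AE \<omega> in M. (\<lambda>n. norm (s n \<omega> - f \<omega>)) \<longlonglongrightarrow> 0"
    using assms(1) by (auto simp: bochner_measurable_def)
  have "(\<lambda>\<omega>. norm (s n \<omega>)) \<in> borel_measurable M" for n
    by (intro borel_measurable_simple_function simple_function_compose1[OF s])
  then have "(\<lambda>\<omega>. lim (\<lambda>n. norm (s n \<omega>))) \<in> borel_measurable (completion M)"
    by (intro measurable_completion borel_measurable_lim_metric)
  moreover have "AE \<omega> in M. lim (\<lambda>n. norm (s n \<omega>)) = norm (f \<omega>)"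
    using lim
  proof eventually_elim
    case (elim \<omega>)
    then have "(\<lambda>n. s n \<omega>) \<longlonglongrightarrow> f \<omega>"
      by (simp add: tendsto_norm_zero_iff LIM_zero_iff)
    then show ?case by (intro limI tendsto_norm)
  qed
  ultimately show ?thesis
    by (rule borel_measurable_completion_cong_AE)
qed


section \<open>The duality between \<open>L\<^sup>p\<close> and \<open>L\<^sup>q\<close>\<close>

lemma Lp_norm_nonneg: "0 \<le> Lp_norm M r F"
  by (simp add: Lp_norm_def)

lemma integral_norm_powr_le:
  assumes "0 < r" and "Lp_norm M r F \<le> s"
  shows "(LINT \<omega>|completion M. norm (F \<omega>) powr r) \<le> s powr r"
proof -
  have "(LINT \<omega>|completion M. norm (F \<omega>) powr r) = Lp_norm M r F powr r"
    using \<open>0 < r\<close> by (simp add: Lp_norm_def powr_powr)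
  also have "\<dots> \<le> s powr r"
    using assms by (intro powr_mono2) (auto simp: Lp_norm_nonneg)
  finally show ?thesis .
qed

lemma conjugate_exponent_gt_1:
  assumes "1 < p" and "1 / p + 1 / q = 1"
  shows "1 < (q::real)"
proof -
  have "1 / q = 1 - 1 / p" using assms(2) by simp
  moreover have "0 < 1 - 1 / p" "1 - 1 / p < 1" using assms(1) by auto
  ultimately have "0 < 1 / q" "1 / q < 1" by auto
  then show ?thesis by (simp add: divide_less_eq)
qed

text \<open>
  As usual, Young's inequality is integrated after normalising. Dividing by numbers \<open>s\<close> and \<open>t\<close>
  strictly above the two norms, and letting them decrease to the norms afterwards, avoids a separate
  treatment of functions that vanish almost everywhere.
\<close>

lemma Holder_pairing:
  fixes \<nu> :: "'k::real_normed_vector \<Rightarrow> 'k \<Rightarrow> 's::{real_normed_field,euclidean_space}"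
  assumes pair: "\<And>v u. norm (\<nu> v u) \<le> norm v * norm u"
    and "1 < p" and pq: "1 / p + 1 / q = 1"
    and F: "F \<in> bochner_Lp M p" and G: "G \<in> bochner_Lp M q"
  shows "norm (LINT \<omega>|completion M. \<nu> (G \<omega>) (F \<omega>)) \<le> Lp_norm M p F * Lp_norm M q G"
proof -
  have "1 < q" using \<open>1 < p\<close> pq by (rule conjugate_exponent_gt_1)
  let ?X = "norm (LINT \<omega>|completion M. \<nu> (G \<omega>) (F \<omega>))"
  have intF: "integrable (completion M) (\<lambda>\<omega>. norm (F \<omega>) powr p)"
    and intG: "integrable (completion M) (\<lambda>\<omega>. norm (G \<omega>) powr q)"
    using F G by (auto simp: bochner_Lp_def)
  have bound: "?X \<le> s * t" if "Lp_norm M p F < s" "Lp_norm M q G < t" for s t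
  proof -
    have st: "0 < s" "0 < t"
      using that Lp_norm_nonneg[of M p F] Lp_norm_nonneg[of M q G] by linarith+
    let ?b = "\<lambda>\<omega>. s * t * (norm (F \<omega>) powr p / (p * s powr p) + norm (G \<omega>) powr q / (q * t powr q))"
    have intb: "integrable (completion M) ?b"
      using intF intG by auto
    have "norm (\<nu> (G \<omega>) (F \<omega>)) \<le> ?b \<omega>" for \<omega>
    proof -
      have "norm (F \<omega>) / s * (norm (G \<omega>) / t)
          \<le> (norm (F \<omega>) / s) powr p / p + (norm (G \<omega>) / t) powr q / q"
        using \<open>1 < p\<close> \<open>1 < q\<close> pq st by (intro Youngs_inequality) auto
      also have "\<dots> = norm (F \<omega>) powr p / (p * s powr p) + norm (G \<omega>) powr q / (q * t powr q)"
        using st by (simp add: powr_divide mult.commute)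
      finally have "norm (G \<omega>) * norm (F \<omega>) \<le> ?b \<omega>"
        using st by (simp add: field_simps)
      with pair show ?thesis by (rule order_trans)
    qed
    then have "?X \<le> (LINT \<omega>|completion M. ?b \<omega>)"
      by (intro order_trans[OF integral_norm_bound] integral_mono_AE'[OF intb])
         (auto intro: order_trans[OF norm_ge_zero])
    also have "\<dots> = s * t * ((LINT \<omega>|completion M. norm (F \<omega>) powr p) / (p * s powr p)
        + (LINT \<omega>|completion M. norm (G \<omega>) powr q) / (q * t powr q))"
      using intF intG by simp
    also have "\<dots> \<le> s * t * (s powr p / (p * s powr p) + t powr q / (q * t powr q))"
      using that st \<open>1 < p\<close> \<open>1 < q\<close>
      by (intro mult_left_mono add_mono divide_right_mono integral_norm_powr_le) auto
    also have "\<dots> = s * t"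
      using st pq by simp
    finally show ?thesis .
  qed
  have bound': "?X \<le> s * Lp_norm M q G" if "Lp_norm M p F < s" for s
  proof -
    have "0 < s" using that Lp_norm_nonneg[of M p F] by linarith
    have "?X / s \<le> Lp_norm M q G"
      by (rule dense_ge) (use bound[OF that] \<open>0 < s\<close> in \<open>simp add: field_simps\<close>)
    then show ?thesis using \<open>0 < s\<close> by (simp add: field_simps)
  qed
  show ?thesis
  proof (cases "Lp_norm M q G = 0")
    case True
    then show ?thesis
      using bound'[of "Lp_norm M p F + 1"] by simp
  next
    case False
    then have "0 < Lp_norm M q G" using Lp_norm_nonneg[of M q G] by linarith
    have "?X / Lp_norm M q G \<le> Lp_norm M p F"
      by (rule dense_ge) (use bound' \<open>0 < Lp_norm M q G\<close> in \<open>simp add: field_simps\<close>)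
    then show ?thesis using \<open>0 < Lp_norm M q G\<close> by (simp add: field_simps)
  qed
qed

text \<open>
  Let \<open>E\<^sub>n\<close> be sets of finite measure, increasing to the whole space, such that \<open>\<parallel>F\<parallel> \<le> n\<close> almost
  everywhere on \<open>E\<^sub>n\<close>. Testing with \<open>G = 1(E\<^sub>n) (J \<circ> F)\<close> gives \<open>I\<^sub>n \<le> C I\<^sub>n\<^bsup>1/q\<^esup>\<close> for the integral \<open>I\<^sub>n\<close> of
  \<open>\<parallel>F\<parallel>\<^sup>p\<close> over \<open>E\<^sub>n\<close>. Since \<open>I\<^sub>n\<close> is finite, it can be cancelled: \<open>I\<^sub>n \<le> C\<^sup>p\<close>. Monotone convergence
  concludes.
\<close>

lemma bochner_Lp_if_pairing_bounded:
  fixes M :: "'w measure" and \<nu> :: "'k::banach \<Rightarrow> 'k \<Rightarrow> 's::{real_normed_field,euclidean_space}"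
  assumes "hilbert_space sc ip" and \<nu>: "isometric_isomorphism_to_dual sc \<nu>"
    and "sigma_finite_measure M"
    and "1 < p" and pq: "1 / p + 1 / q = 1"
    and F: "bochner_measurable M F"
    and "0 \<le> C"
    and bound: "\<And>G. G \<in> bochner_Lp M q \<Longrightarrow>
          norm (LINT \<omega>|completion M. \<nu> (G \<omega>) (F \<omega>)) \<le> C * Lp_norm M q G"
  shows "F \<in> bochner_Lp M p" and "Lp_norm M p F \<le> C"
proof -
  interpret hilbert_space sc ip by fact
  interpret sigma_finite_measure M by fact
  have "1 < q" using \<open>1 < p\<close> pq by (rule conjugate_exponent_gt_1)
  have exps: "(p - 1) * q = p"
    using pq \<open>1 < p\<close> \<open>1 < q\<close> by (simp add: field_simps)
  obtain J where contJ: "continuous_on UNIV J"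
    and norm_J: "norm (J v) = norm v powr (p - 1)"
    and J: "\<nu> (J v) v = of_real (norm v powr p)" for v
    using duality_map_exists[OF \<nu> \<open>1 < p\<close>] by blast
  have [measurable]: "(\<lambda>\<omega>. norm (F \<omega>)) \<in> borel_measurable (completion M)"
    by (rule bochner_measurable_norm[OF F])
  \<comment> \<open>The sets \<open>E n\<close> must be measurable for \<open>M\<close>, so that multiplication by their indicators preserves
    Bochner measurability. The norm of \<open>F\<close> is only measurable for the completion and is therefore
    replaced by a measurable \<open>g\<close> in the definition of \<open>E\<close>.\<close>
  obtain g where [measurable]: "g \<in> borel_measurable M" and g: "AE \<omega> in M. norm (F \<omega>) = g \<omega>"
    using completion_ex_borel_measurable_real[of "\<lambda>\<omega>. norm (F \<omega>)" M] by auto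
  obtain W :: "nat \<Rightarrow> 'w set" where W: "range W \<subseteq> sets M" "(\<Union>n. W n) = space M"
    "\<And>n. emeasure M (W n) \<noteq> \<infinity>" "incseq W"
    using sigma_finite_incseq by blast
  have [measurable]: "W n \<in> sets M" for n using W(1) by auto
  define E where "E n = {\<omega> \<in> space M. g \<omega> \<le> real n} \<inter> W n" for n
  have E[measurable]: "E n \<in> sets M" for n unfolding E_def by measurable
  have E_finite: "emeasure (completion M) (E n) < \<infinity>" for n
  proof -
    have "emeasure M (E n) \<le> emeasure M (W n)"
      by (intro emeasure_mono) (auto simp: E_def)
    then show ?thesis
      using W(3)[of n] E by (simp add: top.not_eq_extremum order_le_less_trans)
  qed
  define f where "f n \<omega> = indicator (E n) \<omega> * norm (F \<omega>) powr p" for n \<omega>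
  define I where "I n = (LINT \<omega>|completion M. f n \<omega>)" for n
  have int_f: "integrable (completion M) (f n)" for n
  proof -
    have "AE \<omega> in completion M. \<omega> \<in> E n \<longrightarrow> norm (norm (F \<omega>) powr p) \<le> real n powr p"
      using AE_completion[OF g]
    proof eventually_elim
      case (elim \<omega>)
      then show ?case using \<open>1 < p\<close> by (auto simp: E_def simp flip: elim intro!: powr_mono2)
    qed
    then have "integrable (completion M) (\<lambda>\<omega>. indicator (E n) \<omega> *\<^sub>R (norm (F \<omega>) powr p))"
      using E_finite by (intro integrableI_bounded_set_indicator) auto
    then show ?thesis by (simp add: f_def[abs_def])
  qed
  have f_nonneg: "0 \<le> f n \<omega>" for n \<omega>
    by (simp add: f_def)
  then have I_nonneg: "0 \<le> I n" for n
    unfolding I_def by (intro Bochner_Integration.integral_nonneg)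
  have I_le: "I n \<le> C powr p" for n
  proof -
    define G where "G \<omega> = indicator (E n) \<omega> *\<^sub>R J (F \<omega>)" for \<omega>
    have norm_G: "norm (G \<omega>) powr q = f n \<omega>" for \<omega>
      by (simp add: G_def f_def norm_J powr_powr exps split: split_indicator)
    have "bochner_measurable M G"
      using bochner_measurable_indicator_scaleR[OF bochner_measurable_compose[OF F contJ] E]
      by (simp add: G_def[abs_def])
    then have "G \<in> bochner_Lp M q"
      using int_f by (simp add: bochner_Lp_def norm_G)
    moreover have "\<nu> (G \<omega>) (F \<omega>) = of_real (f n \<omega>)" for \<omega>
    proof -
      have "\<nu> (G \<omega>) (F \<omega>) = \<nu> (sc (of_real (indicator (E n) \<omega>)) (J (F \<omega>))) (F \<omega>)"
        by (simp only: G_def scale_of_real)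
      also have "\<dots> = of_real (indicator (E n) \<omega>) * \<nu> (J (F \<omega>)) (F \<omega>)"
        using \<nu> by (simp add: isometric_isomorphism_to_dual_def)
      finally show ?thesis by (simp add: J f_def)
    qed
    moreover have "(LINT \<omega>|completion M. (of_real (f n \<omega>) :: 's)) = of_real (I n)"
      using int_f by (simp add: of_real_def I_def)
    ultimately have "\<bar>I n\<bar> \<le> C * Lp_norm M q G"
      using bound[of G] by simp
    then have *: "I n \<le> C * I n powr (1 / q)"
      by (simp add: Lp_norm_def norm_G I_def)
    show ?thesis
    proof (cases "I n = 0")
      case False
      then have "0 < I n" using I_nonneg[of n] by linarith
      have "I n powr (1 / p) * I n powr (1 / q) = I n"
        using \<open>0 < I n\<close> pq by (simp flip: powr_add)
      with * have "I n powr (1 / p) * I n powr (1 / q) \<le> C * I n powr (1 / q)"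
        by simp
      then have "I n powr (1 / p) \<le> C"
        using \<open>0 < I n\<close> by simp
      then have "(I n powr (1 / p)) powr p \<le> C powr p"
        using \<open>1 < p\<close> by (intro powr_mono2) auto
      then show ?thesis using \<open>0 < I n\<close> \<open>1 < p\<close> by (simp add: powr_powr)
    qed simp
  qed
  have "incseq E"
    using W(4) by (force simp: E_def incseq_def)
  then have mono_f: "mono (\<lambda>n. f n \<omega>)" for \<omega>
    by (auto simp: f_def mono_def incseq_def split: split_indicator)
  have lim_f: "(\<lambda>n. f n \<omega>) \<longlonglongrightarrow> norm (F \<omega>) powr p" if "\<omega> \<in> space M" for \<omega>
  proof (rule tendsto_eventually)
    have "\<omega> \<in> (\<Union>n. W n)" using that by (simp only: W(2))
    then obtain i where i: "\<omega> \<in> W i" by blast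
    have "f n \<omega> = norm (F \<omega>) powr p" if "max i (nat \<lceil>g \<omega>\<rceil>) \<le> n" for n
    proof -
      have "\<omega> \<in> W n" using i W(4) that by (auto simp: incseq_def)
      moreover have "g \<omega> \<le> real n" using that by linarith
      ultimately show ?thesis using \<open>\<omega> \<in> space M\<close> by (simp add: f_def E_def)
    qed
    then show "eventually (\<lambda>n. f n \<omega> = norm (F \<omega>) powr p) sequentially"
      by (rule eventually_sequentiallyI)
  qed
  have "incseq I"
    unfolding I_def incseq_def using mono_f int_f
    by (auto intro!: integral_mono simp: mono_def)
  then obtain L where L: "I \<longlonglongrightarrow> L" "\<And>n. I n \<le> L"
    using incseq_convergent[of I "C powr p"] I_le by blast
  have "L \<le> C powr p"
    by (rule LIMSEQ_le_const2[OF L(1)]) (use I_le in auto)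
  have "AE \<omega> in completion M. mono (\<lambda>n. f n \<omega>)"
    and "AE \<omega> in completion M. 0 \<le> f n \<omega>"
    and "AE \<omega> in completion M. (\<lambda>n. f n \<omega>) \<longlonglongrightarrow> norm (F \<omega>) powr p"
    and "(\<lambda>n. LINT \<omega>|completion M. f n \<omega>) \<longlonglongrightarrow> L"
    and "(\<lambda>\<omega>. norm (F \<omega>) powr p) \<in> borel_measurable (completion M)" for n
    using mono_f f_nonneg lim_f L(1) by (auto simp: I_def[abs_def])
  note integral_monotone_convergence_nonneg[OF int_f this]
  then have "integrable (completion M) (\<lambda>\<omega>. norm (F \<omega>) powr p)"
    and int_eq: "(LINT \<omega>|completion M. norm (F \<omega>) powr p) = L"
    by blast+
  then show "F \<in> bochner_Lp M p"
    using F by (simp add: bochner_Lp_def)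
  have "0 \<le> L" using I_nonneg[of 0] L(2)[of 0] by linarith
  then have "Lp_norm M p F \<le> (C powr p) powr (1 / p)"
    unfolding Lp_norm_def int_eq using \<open>L \<le> C powr p\<close> \<open>1 < p\<close> by (intro powr_mono2) auto
  then show "Lp_norm M p F \<le> C"
    using \<open>1 < p\<close> \<open>0 \<le> C\<close> by (simp add: powr_powr)
qed


section \<open>Perturbation of Bochner pg-frames\<close>

theorem theorem4p1:
  fixes M :: "'w measure"
    and scX :: "'s::{real_normed_field,euclidean_space} \<Rightarrow> 'x::banach \<Rightarrow> 'x"
    and scK :: "'s \<Rightarrow> 'k::banach \<Rightarrow> 'k"
    and ip :: "'k \<Rightarrow> 'k \<Rightarrow> 's"
    and H :: "'w \<Rightarrow> 'k set"
    and \<nu> :: "'k \<Rightarrow> 'k \<Rightarrow> 's"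
    and \<Lambda> \<Theta> :: "'w \<Rightarrow> 'x \<Rightarrow> 'k"
    and p q A B l1 l2 \<gamma> :: real
  assumes "banach_space scX"
    and "hilbert_space scK ip"
    and "hilbert_direct_sum scK ip (space M) H"
    and "isometric_isomorphism_to_dual scK \<nu>"
    and "sigma_finite_measure M"
    and "1 < p" and "1 / p + 1 / q = 1"
    and "bochner_pg_frame M p scX scK H \<Lambda> A B"
    and "\<And>\<omega>. \<omega> \<in> space M \<Longrightarrow> \<Theta> \<omega> \<in> bounded_operators scX scK (H \<omega>)"
    and "\<And>x. bochner_measurable M (\<lambda>\<omega>. \<Theta> \<omega> x)"
    and "0 \<le> l2" and "l2 < 1" and "- l2 \<le> l1" and "l1 < 1"
    and "0 \<le> \<gamma>" and "\<gamma> < (1 - l1 - 2 * l2) * A"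
    and "\<And>G x. G \<in> bochner_Lp M q \<Longrightarrow>
           integrable (completion M) (\<lambda>\<omega>. \<nu> (G \<omega>) (\<Lambda> \<omega> x - \<Theta> \<omega> x)) \<and>
           integrable (completion M) (\<lambda>\<omega>. \<nu> (G \<omega>) (\<Lambda> \<omega> x)) \<and>
           integrable (completion M) (\<lambda>\<omega>. \<nu> (G \<omega>) (\<Theta> \<omega> x))"
    and "\<And>G x. G \<in> bochner_Lp M q \<Longrightarrow>
           norm (LINT \<omega>|completion M. \<nu> (G \<omega>) (\<Lambda> \<omega> x - \<Theta> \<omega> x))
             \<le> l1 * norm (LINT \<omega>|completion M. \<nu> (G \<omega>) (\<Lambda> \<omega> x))
               + l2 * norm (LINT \<omega>|completion M. \<nu> (G \<omega>) (\<Theta> \<omega> x))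
               + \<gamma> * Lp_norm M q G"
  shows "bochner_pg_frame M p scX scK H \<Theta>
           (A * (((1 - l1 - 2 * l2) - \<gamma> / A) / (1 - l2)))
           (B * ((1 + l1 + \<gamma> / B) / (1 - l2)))"
proof -
  note \<nu> = assms(4) and p = assms(6) and pq = assms(7) and int = assms(17)
  note \<nu>_linear = bounded_linear.linear[OF bounded_linear_dual_pairing[OF \<nu>]]
  have AB: "0 < A" "0 < B"
    and \<Lambda>_op: "\<And>\<omega>. \<omega> \<in> space M \<Longrightarrow> \<Lambda> \<omega> \<in> bounded_operators scX scK (H \<omega>)"
    and \<Lambda>_Lp: "\<And>x. (\<lambda>\<omega>. \<Lambda> \<omega> x) \<in> bochner_Lp M p"
    and lower: "\<And>x. A * norm x \<le> Lp_norm M p (\<lambda>\<omega>. \<Lambda> \<omega> x)"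
    and upper: "\<And>x. Lp_norm M p (\<lambda>\<omega>. \<Lambda> \<omega> x) \<le> B * norm x"
    using assms(8) by (auto simp: bochner_pg_frame_def)
  define a where "a G x = (LINT \<omega>|completion M. \<nu> (G \<omega>) (\<Lambda> \<omega> x))" for G x
  define b where "b G x = (LINT \<omega>|completion M. \<nu> (G \<omega>) (\<Theta> \<omega> x))" for G x
  have scale: "a G (r *\<^sub>R x) = r *\<^sub>R a G x" "b G (r *\<^sub>R x) = r *\<^sub>R b G x" for G x r
  proof -
    have hom: "\<nu> (G \<omega>) (T (r *\<^sub>R x)) = r *\<^sub>R \<nu> (G \<omega>) (T x)"
      if "T \<in> bounded_operators scX scK (H \<omega>)" for T \<omega>
      using that by (simp add: bounded_operators_def bounded_linear.linear linear_cmul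
          linear_cmul[OF \<nu>_linear])
    have "a G (r *\<^sub>R x) = (LINT \<omega>|completion M. r *\<^sub>R \<nu> (G \<omega>) (\<Lambda> \<omega> x))"
      unfolding a_def by (intro Bochner_Integration.integral_cong refl hom \<Lambda>_op) simp
    then show "a G (r *\<^sub>R x) = r *\<^sub>R a G x"
      by (simp add: a_def)
    have "b G (r *\<^sub>R x) = (LINT \<omega>|completion M. r *\<^sub>R \<nu> (G \<omega>) (\<Theta> \<omega> x))"
      unfolding b_def by (intro Bochner_Integration.integral_cong refl hom assms(9)) simp
    then show "b G (r *\<^sub>R x) = r *\<^sub>R b G x"
      by (simp add: b_def)
  qed
  have diff: "(LINT \<omega>|completion M. \<nu> (G \<omega>) (\<Lambda> \<omega> x - \<Theta> \<omega> x)) = a G x - b G x"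
    if "G \<in> bochner_Lp M q" for G x
    using int[OF that, of x] by (simp add: a_def b_def linear_diff[OF \<nu>_linear])
  have pert: "norm (a G x - b G x) \<le> l1 * norm (a G x) + l2 * norm (b G x)"
    if G: "G \<in> bochner_Lp M q" for G x
    \<comment> \<open>The inequality for \<open>(n + 1) x\<close>, divided by \<open>n + 1\<close>, in the limit.\<close>
  proof (rule LIMSEQ_le_const)
    let ?d = "l1 * norm (a G x) + l2 * norm (b G x)"
    show "(\<lambda>n. ?d + \<gamma> * Lp_norm M q G / real (Suc n)) \<longlonglongrightarrow> ?d"
      by (rule tendsto_eq_intros refl LIMSEQ_Suc[OF lim_const_over_n])+ simp
    have "norm (a G x - b G x) \<le> ?d + \<gamma> * Lp_norm M q G / real (Suc n)" for n
    proof -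
      have "norm (real (Suc n) *\<^sub>R (a G x - b G x))
          \<le> l1 * norm (real (Suc n) *\<^sub>R a G x) + l2 * norm (real (Suc n) *\<^sub>R b G x)
            + \<gamma> * Lp_norm M q G"
        using assms(18)[OF G, of "real (Suc n) *\<^sub>R x"] 
        unfolding diff[OF G] unfolding a_def[symmetric] b_def[symmetric] scale scaleR_diff_right .
      then have "real (Suc n) * norm (a G x - b G x) \<le> real (Suc n) * ?d + \<gamma> * Lp_norm M q G"
        by (simp only: norm_scaleR abs_of_nat) (simp add: algebra_simps)
      then show ?thesis by (simp add: field_simps del: of_nat_Suc)
    qed
    then show "\<exists>N. \<forall>n\<ge>N. norm (a G x - b G x) \<le> ?d + \<gamma> * Lp_norm M q G / real (Suc n)"
      by blast
  qed
  have l: "0 < 1 - l2" "0 < 1 - l1" "0 < 1 + l2" "0 < 1 + l1"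
    using assms by linarith+
  have b_le: "norm (b G x) \<le> (1 + l1) / (1 - l2) * norm (a G x)"
    and a_le: "norm (a G x) \<le> (1 + l2) / (1 - l1) * norm (b G x)"
    if "G \<in> bochner_Lp M q" for G x
  proof -
    have "(1 - l2) * norm (b G x) \<le> (1 + l1) * norm (a G x)"
      using pert[OF that, of x] norm_triangle_ineq2[of "b G x" "a G x"]
      by (simp add: norm_minus_commute algebra_simps)
    then show "norm (b G x) \<le> (1 + l1) / (1 - l2) * norm (a G x)"
      using l by (simp add: field_simps)
    have "(1 - l1) * norm (a G x) \<le> (1 + l2) * norm (b G x)"
      using pert[OF that, of x] norm_triangle_ineq2[of "a G x" "b G x"]
      by (simp add: algebra_simps)
    then show "norm (a G x) \<le> (1 + l2) / (1 - l1) * norm (b G x)"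
      using l by (simp add: field_simps)
  qed
  note pair = dual_pairing_norm_le[OF \<nu>]
  note converse = bochner_Lp_if_pairing_bounded[OF assms(2) \<nu> assms(5) p pq]
  have \<Theta>_Lp: "(\<lambda>\<omega>. \<Theta> \<omega> x) \<in> bochner_Lp M p"
    and \<Theta>_upper: "Lp_norm M p (\<lambda>\<omega>. \<Theta> \<omega> x)
        \<le> (1 + l1) / (1 - l2) * Lp_norm M p (\<lambda>\<omega>. \<Lambda> \<omega> x)" for x
  proof -
    have "norm (LINT \<omega>|completion M. \<nu> (G \<omega>) (\<Theta> \<omega> x))
        \<le> (1 + l1) / (1 - l2) * Lp_norm M p (\<lambda>\<omega>. \<Lambda> \<omega> x) * Lp_norm M q G"
      if G: "G \<in> bochner_Lp M q" for G
    proof -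
      have "norm (b G x) \<le> (1 + l1) / (1 - l2) * norm (a G x)"
        by (rule b_le[OF G])
      also have "\<dots> \<le> (1 + l1) / (1 - l2) * (Lp_norm M p (\<lambda>\<omega>. \<Lambda> \<omega> x) * Lp_norm M q G)"
        using l Holder_pairing[OF pair p pq \<Lambda>_Lp G]
        by (intro mult_left_mono) (auto simp: a_def)
      finally show ?thesis by (simp add: b_def mult.assoc)
    qed
    note bnd = this
    have "0 \<le> (1 + l1) / (1 - l2) * Lp_norm M p (\<lambda>\<omega>. \<Lambda> \<omega> x)"
      using l by (simp add: Lp_norm_nonneg)
    note converse[OF assms(10) this bnd]
    then show "(\<lambda>\<omega>. \<Theta> \<omega> x) \<in> bochner_Lp M p"
      and "Lp_norm M p (\<lambda>\<omega>. \<Theta> \<omega> x) \<le> (1 + l1) / (1 - l2) * Lp_norm M p (\<lambda>\<omega>. \<Lambda> \<omega> x)"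
      by auto
  qed
  have \<Lambda>_upper: "Lp_norm M p (\<lambda>\<omega>. \<Lambda> \<omega> x)
      \<le> (1 + l2) / (1 - l1) * Lp_norm M p (\<lambda>\<omega>. \<Theta> \<omega> x)" for x
  proof (rule converse(2))
    show "bochner_measurable M (\<lambda>\<omega>. \<Lambda> \<omega> x)"
      using \<Lambda>_Lp by (simp add: bochner_Lp_def)
    show "0 \<le> (1 + l2) / (1 - l1) * Lp_norm M p (\<lambda>\<omega>. \<Theta> \<omega> x)"
      using l by (simp add: Lp_norm_nonneg)
    fix G :: "'w \<Rightarrow> 'k" assume G: "G \<in> bochner_Lp M q"
    have "norm (a G x) \<le> (1 + l2) / (1 - l1) * norm (b G x)"
      by (rule a_le[OF G])
    also have "\<dots> \<le> (1 + l2) / (1 - l1) * (Lp_norm M p (\<lambda>\<omega>. \<Theta> \<omega> x) * Lp_norm M q G)"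
      using l Holder_pairing[OF pair p pq \<Theta>_Lp G]
      by (intro mult_left_mono) (auto simp: b_def)
    finally show "norm (LINT \<omega>|completion M. \<nu> (G \<omega>) (\<Lambda> \<omega> x))
        \<le> (1 + l2) / (1 - l1) * Lp_norm M p (\<lambda>\<omega>. \<Theta> \<omega> x) * Lp_norm M q G"
      by (simp add: a_def mult.assoc)
  qed
  let ?A = "A * (((1 - l1 - 2 * l2) - \<gamma> / A) / (1 - l2))"
  let ?B = "B * ((1 + l1 + \<gamma> / B) / (1 - l2))"
  have "?A = ((1 - l1 - 2 * l2) * A - \<gamma>) / (1 - l2)"
    using AB l by (simp add: field_simps)
  then have "0 < ?A" using assms(16) l by simp
  have "0 < ?B"
    using l(1,4) AB(2) divide_nonneg_pos[OF \<open>0 \<le> \<gamma>\<close> AB(2)]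
    by (intro mult_pos_pos divide_pos_pos) linarith+
  have A_le: "?A \<le> A * ((1 - l1) / (1 + l2))"
  proof (intro mult_left_mono)
    have "(1 - l1 - 2 * l2) * (1 + l2) \<le> (1 - l1) * (1 - l2)"
    proof -
      have "(1 - l1) * (1 - l2) - (1 - l1 - 2 * l2) * (1 + l2) = 2 * (l2 * (l1 + l2))"
        by (simp add: algebra_simps)
      moreover have "0 \<le> l2 * (l1 + l2)"
        using assms(11,13) by simp
      ultimately show ?thesis by linarith
    qed
    then have "(1 - l1 - 2 * l2) / (1 - l2) \<le> (1 - l1) / (1 + l2)"
      using l by (simp add: divide_le_eq pos_le_divide_eq mult.commute)
    moreover have "((1 - l1 - 2 * l2) - \<gamma> / A) / (1 - l2) \<le> (1 - l1 - 2 * l2) / (1 - l2)"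
      using l AB \<open>0 \<le> \<gamma>\<close> by (intro divide_right_mono) auto
    ultimately show "((1 - l1 - 2 * l2) - \<gamma> / A) / (1 - l2) \<le> (1 - l1) / (1 + l2)"
      by linarith
  qed (use AB in simp)
  have "?A * norm x \<le> Lp_norm M p (\<lambda>\<omega>. \<Theta> \<omega> x)" for x
  proof -
    have "?A * norm x \<le> (1 - l1) / (1 + l2) * (A * norm x)"
      using mult_right_mono[OF A_le norm_ge_zero, of x] by (simp add: mult_ac)
    also have "\<dots> \<le> (1 - l1) / (1 + l2) * ((1 + l2) / (1 - l1) * Lp_norm M p (\<lambda>\<omega>. \<Theta> \<omega> x))"
      using l lower[of x] \<Lambda>_upper[of x] by (intro mult_left_mono) auto
    also have "\<dots> = Lp_norm M p (\<lambda>\<omega>. \<Theta> \<omega> x)"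
      using l by simp
    finally show ?thesis .
  qed
  moreover have "Lp_norm M p (\<lambda>\<omega>. \<Theta> \<omega> x) \<le> ?B * norm x" for x
  proof -
    have "Lp_norm M p (\<lambda>\<omega>. \<Theta> \<omega> x) \<le> (1 + l1) / (1 - l2) * (B * norm x)"
      using \<Theta>_upper[of x] upper[of x] l
      by (elim order_trans) (intro mult_left_mono, auto)
    also have "\<dots> = B * ((1 + l1) / (1 - l2)) * norm x"
      by simp
    also have "\<dots> \<le> ?B * norm x"
    proof (intro mult_right_mono mult_left_mono)
      show "(1 + l1) / (1 - l2) \<le> (1 + l1 + \<gamma> / B) / (1 - l2)"
        using l AB \<open>0 \<le> \<gamma>\<close> by (intro divide_right_mono) auto
    qed (use AB in auto)
    finally show ?thesis .
  qed
  ultimately show ?thesis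
    using \<open>0 < ?A\<close> \<open>0 < ?B\<close> \<Theta>_Lp assms(9) by (simp add: bochner_pg_frame_def)
qed

end
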